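(* Consider the online regression task with i.i.d. inputs $x_1,x_2,\dots$, squared loss $\ell(x;\theta)=\|\hat f(x;\theta)-f(x)\|_2^2$, target $f\in\mathcal F$, and model errors $r_f=\inf_{\theta\in\Theta}\langle\ell(x;\theta)\rangle$ and $r_2=\sup_{g\in\mathcal F}r_g$ as described in the context. Assume that the prediction algorithm suffers sub-linear external regret, i.e. the $\theta_t$ are chosen such that there exists $\Delta\in o(T)$ with $$\sum_{t=1}^T\ell(x_t;\theta_t)\le\inf_{\theta\in\Theta}\sum_{t=1}^T\ell(x_t;\theta)+\Delta(T)\qquad\text{for all }T\in\mathbb N.$$ Then the sequence $(\langle\ell(x_t;\theta_t)\rangle)_{t\in\mathbb N}$ of expected prediction losses converges with increasing permanence to $r_f$, which is at most the representational error: $$\langle\ell(x_t;\theta_t)\rangle\rightsquigarrow r_f\in[0,r_2]\quad(t\to\infty).$$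
   Context: Convergence with increasing permanence: a real sequence $(s_t)_{t\in\mathbb N}$ converges to $s'\in\mathbb R$ with increasing permanence, written $s_t\rightsquigarrow s'$, iff for all $\epsilon>0$ and all $D,N\in\mathbb N$ there exists $n\in\mathbb N$, $n\ge N$, such that $|s'-s_{n+i}|\le\epsilon$ for all $i\in\{1,\dots,D\}$. Online regression setting: the target $f:\mathcal X\to\mathcal Y$ belongs to a function class $\mathcal F$, where $\mathcal Y$ is a Euclidean space with norm $\|\cdot\|_2$. The hypothesis space is $\hat{\mathcal F}=\{\hat f(\cdot;\theta):\theta\in\Theta\}$. The inputs $x_t$ $(t\in\mathbb N)$ are drawn i.i.d. from a distribution $p$ with support $\mathcal X$. At each stage $t$ the parameter $\theta_t\in\Theta$ is picked based on the history $\mathbb I_t$ of past observations $(x_i,y_i)$, $y_i=f(x_i)$ (or just past losses $\ell(x_i;\theta_i)$), $i<t$; afterwards $x_t$ and the loss are revealed. Thus $x_t$ is independent of $(\theta_t,\mathbb I_t)$. All functions are measurable as needed. $\langle\cdot\rangle$ denotes expectation; in $\langle\ell(x;\theta)\rangle=\int_{\mathcal X}\ell(x;\theta)\,dp(x)$ the expectation is over $x\sim p$ for fixed $\theta$, and in $\langle\ell(x_t;\theta_t)\rangle$ it is over all randomness. For $g\in\mathcal F$, $r_g=\inf_{\hat g\in\hat{\mathcal F}}\langle\|g-\hat g\|_2^2\rangle$; in particular $r_f=\inf_{\theta}\langle\ell(x;\theta)\rangle$, which is assumed finite. $r_2=\sup_{g\in\mathcal F}r_g\in[0,\infty]$. $\Delta$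 is a deterministic function with $\Delta(T)/T\to0$, and the regret inequality holds for every realisation. *)

theory Defs
  imports "HOL-Probability.Probability" "HOL-Library.Landau_Symbols"
begin

definition converges_with_increasing_permanence :: "(nat \<Rightarrow> real) \<Rightarrow> real \<Rightarrow> bool" where
  "converges_with_increasing_permanence s s' \<longleftrightarrow>
     (\<forall>\<epsilon>>0. \<forall>D N :: nat. \<exists>n\<ge>N. \<forall>i\<in>{1..D}. \<bar>s' - s (n + i)\<bar> \<le> \<epsilon>)"

definition sq_loss :: "('x \<Rightarrow> 'p \<Rightarrow> 'y::euclidean_space) \<Rightarrow> ('x \<Rightarrow> 'y) \<Rightarrow> 'x \<Rightarrow> 'p \<Rightarrow> real" where
  "sq_loss fhat f x \<theta> = (norm (fhat x \<theta> - f x))\<^sup>2"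

definition hypothesis_space :: "'p set \<Rightarrow> ('x \<Rightarrow> 'p \<Rightarrow> 'y) \<Rightarrow> ('x \<Rightarrow> 'y) set" where
  "hypothesis_space \<Theta> fhat = (\<lambda>\<theta> x. fhat x \<theta>) ` \<Theta>"

text \<open>
  Mean squared errors are taken in \<^typ>\<open>ennreal\<close>: individual hypotheses may have infinite risk,
  and the supremum over the target class may be infinite.
\<close>

definition model_error ::
  "'x measure \<Rightarrow> ('x \<Rightarrow> 'y::euclidean_space) set \<Rightarrow> ('x \<Rightarrow> 'y) \<Rightarrow> ennreal" where
  "model_error p H g = (INF h\<in>H. \<integral>\<^sup>+x. ennreal ((norm (g x - h x))\<^sup>2) \<partial>p)"

definition representational_error ::
  "'x measure \<Rightarrow> ('x \<Rightarrow> 'y::euclidean_space) set \<Rightarrow> ('x \<Rightarrow> 'y) set \<Rightarrow> ennreal" where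
  "representational_error p H F = (SUP g\<in>F. model_error p H g)"

lemma model_error_hypothesis_space:
  "model_error p (hypothesis_space \<Theta> fhat) f = (INF \<theta>\<in>\<Theta>. \<integral>\<^sup>+x. ennreal (sq_loss fhat f x \<theta>) \<partial>p)"
  by (simp add: model_error_def hypothesis_space_def sq_loss_def image_image norm_minus_commute)

text \<open>
  Stages are numbered from 1; the values \<open>x 0\<close> and \<open>\<theta> 0\<close> are never used.
  The bound \<open>\<Delta>\<close> is deterministic and the inequality holds for every outcome \<open>\<omega>\<close>.
\<close>

definition sublinear_external_regret ::
  "'w set \<Rightarrow> 'p set \<Rightarrow> ('x \<Rightarrow> 'p \<Rightarrow> real) \<Rightarrow> (nat \<Rightarrow> 'w \<Rightarrow> 'x) \<Rightarrow> (nat \<Rightarrow> 'w \<Rightarrow> 'p) \<Rightarrow> bool" where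
  "sublinear_external_regret \<Omega> \<Theta> l x \<theta> \<longleftrightarrow>
     (\<exists>\<Delta> :: nat \<Rightarrow> real. \<Delta> \<in> o(\<lambda>T. real T) \<and>
        (\<forall>\<omega>\<in>\<Omega>. \<forall>T\<ge>1. (\<Sum>t=1..T. l (x t \<omega>) (\<theta> t \<omega>)) \<le>
           (INF \<theta>'\<in>\<Theta>. \<Sum>t=1..T. l (x t \<omega>) \<theta>') + \<Delta> T))"

text \<open>
  The measurable space \<open>p\<close> carries the input distribution (inputs range over \<^term>\<open>space p\<close>) and
  \<open>\<Theta>\<close> the parameter set \<^term>\<open>space \<Theta>\<close> with a sigma-algebra. The sigma-algebra \<open>I t\<close> is the
  information on which \<open>\<theta> t\<close> is based; it may include internal randomness of the algorithm.
  It contains at least the past losses. If instead the past pairs \<open>(x i, f (x i))\<close> are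
  observed, this is automatic, since \<open>\<theta> i\<close> is measurable with respect to \<open>I i\<close>, hence to \<open>I t\<close>.
\<close>

locale online_regression = prob_space M + filtration "space M" I
  for M :: "'w measure" and I :: "nat \<Rightarrow> 'w measure" +
  fixes p :: "'x measure"
    and \<Theta> :: "'p measure"
    and fhat :: "'x \<Rightarrow> 'p \<Rightarrow> 'y::euclidean_space"
    and F :: "('x \<Rightarrow> 'y) set"
    and f :: "'x \<Rightarrow> 'y"
    and x :: "nat \<Rightarrow> 'w \<Rightarrow> 'x"
    and \<theta> :: "nat \<Rightarrow> 'w \<Rightarrow> 'p"
  assumes prob_space_p: "prob_space p"
    and fhat_measurable: "(\<lambda>(z, q). fhat z q) \<in> borel_measurable (p \<Otimes>\<^sub>M \<Theta>)"
    and F_measurable: "F \<subseteq> borel_measurable p"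
    and target_in_class: "f \<in> F"
    and x_indep: "indep_vars (\<lambda>_. p) x {1..}"
    and x_distr: "\<And>t. t \<ge> 1 \<Longrightarrow> distr M p (x t) = p"
    and information_subalgebra: "\<And>t. subalgebra M (I t)"
    and past_losses_observed: "\<And>i t. \<lbrakk>1 \<le> i; i < t\<rbrakk> \<Longrightarrow>
          (\<lambda>\<omega>. sq_loss fhat f (x i \<omega>) (\<theta> i \<omega>)) \<in> borel_measurable (I t)"
    and parameter_from_information: "\<And>t. t \<ge> 1 \<Longrightarrow> \<theta> t \<in> measurable (I t) \<Theta>"
    and input_indep_information: "\<And>t. t \<ge> 1 \<Longrightarrow>
          indep_set (sets (vimage_algebra (space M) (x t) p)) (sets (I t))"

end

theory Submission
  imports Defs
begin

text \<open>
  Since \<open>x t\<close> is independent of \<open>\<theta> t\<close>, every expected loss is at least \<open>r_f\<close>. Comparing with one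
  near-optimal fixed parameter, sub-linear regret forces the Cesaro means of the expected losses to
  have upper limit at most \<open>r_f\<close>. So the excesses over \<open>r_f\<close> are nonnegative with vanishing
  averages, and an excess above \<open>\<epsilon>\<close> cannot recur in every window of length \<open>D\<close>.
\<close>

text \<open>The lower bound turns each deviation from \<open>s'\<close> into a nonnegative excess,
  so nothing can cancel in the averages. If permanence failed for \<open>\<epsilon>\<close>,
  \<open>D\<close>, \<open>N\<close>, each window of length \<open>D\<close> past \<open>N\<close>
  would contain an excess above \<open>\<epsilon>\<close>, keeping the mean excess asymptotically at
  \<open>\<epsilon> / D\<close> or more.\<close>

lemma converges_with_increasing_permanence_average:
  fixes s :: "nat \<Rightarrow> real"
  assumes lower: "\<And>t. t \<ge> 1 \<Longrightarrow> s' \<le> s t"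
    and average: "\<And>e. e > 0 \<Longrightarrow> \<forall>\<^sub>F T in sequentially. (\<Sum>t=1..T. s t) \<le> real T * (s' + e)"
  shows "converges_with_increasing_permanence s s'"
proof (rule ccontr)
  assume "\<not> ?thesis"
  then obtain \<epsilon> D N where \<epsilon>: "\<epsilon> > 0"
    and bad: "\<And>n. n \<ge> N \<Longrightarrow> \<exists>i\<in>{1..D}. \<epsilon> < \<bar>s' - s (n + i)\<bar>"
    unfolding converges_with_increasing_permanence_def by (force simp: not_le)
  have D: "D > 0" using bad[of N] by auto
  define a where "a t = s t - s'" for t
  have a_nonneg: "0 \<le> a t" if "t \<ge> 1" for t
    using lower[OF that] by (simp add: a_def)
  \<comment> \<open>The \<open>k\<close> consecutive windows after \<open>N\<close> are disjoint, so
    their excesses add up; the first \<open>N\<close> terms contribute a nonnegative amount.\<close>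
  have windows: "real k * \<epsilon> \<le> (\<Sum>t=1..N + k * D. a t)" for k
  proof (induction k)
    case 0
    show ?case by (auto intro!: sum_nonneg a_nonneg)
  next
    case (Suc k)
    define n where "n = N + k * D"
    obtain i where i: "i \<in> {1..D}" "\<epsilon> < \<bar>s' - s (n + i)\<bar>"
      using bad[of n] by (auto simp: n_def)
    have "\<epsilon> \<le> a (n + i)"
      using i lower[of "n + i"] by (auto simp: a_def)
    also have "\<dots> \<le> (\<Sum>t=n+1..n+D. a t)"
      using i by (intro member_le_sum) (auto intro: a_nonneg)
    finally have "\<epsilon> \<le> (\<Sum>t=n+1..n+D. a t)" .
    moreover have "(\<Sum>t=1..n + D. a t) = (\<Sum>t=1..n. a t) + (\<Sum>t=n+1..n+D. a t)"
      by (rule sum.ub_add_nat) simp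
    moreover have "N + Suc k * D = n + D" by (simp add: n_def)
    ultimately show ?case
      using Suc.IH by (simp add: n_def algebra_simps)
  qed
  \<comment> \<open>Half of the mean excess that the windows force; the spare factor 2 absorbs the
    initial segment of length \<open>N\<close>.\<close>
  have "\<epsilon> / (2 * real D) > 0" using \<epsilon> D by simp
  from average[OF this] obtain T0 where T0:
    "\<And>T. T \<ge> T0 \<Longrightarrow> (\<Sum>t=1..T. s t) \<le> real T * (s' + \<epsilon> / (2 * real D))"
    by (auto simp: eventually_sequentially)
  \<comment> \<open>\<open>k > N\<close> makes the final inequality \<open>k * D \<le> N\<close>
    absurd, and \<open>k \<ge> T0\<close> places \<open>T\<close> where the average bound is
    valid.\<close>
  define k where "k = N + T0 + 1"
  define T where "T = N + k * D"
  have kD: "k \<le> k * D" using D by simp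
  have "T0 \<le> T" using kD by (simp add: T_def k_def)
  have "real k * \<epsilon> \<le> (\<Sum>t=1..T. a t)" using windows[of k] by (simp add: T_def)
  also have "\<dots> = (\<Sum>t=1..T. s t) - real T * s'"
    by (simp add: a_def sum_subtractf)
  also have "\<dots> \<le> real T * (\<epsilon> / (2 * real D))"
    using T0[OF \<open>T0 \<le> T\<close>] by (simp add: algebra_simps)
  finally have "\<epsilon> * (2 * real D * real k) \<le> \<epsilon> * real T"
    using D by (simp add: field_simps)
  then have "2 * real D * real k \<le> real T"
    using \<epsilon> by simp
  then have "real (2 * D * k) \<le> real T" by simp
  then have "2 * D * k \<le> N + k * D" unfolding T_def by (simp only: of_nat_le_iff)
  then have "k * D \<le> N" by (simp add: algebra_simps)
  with kD show False by (simp add: k_def)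
qed

section \<open>Independence of input and parameter, and the lower bound on expected losses\<close>

context online_regression
begin

abbreviation risk :: "'p \<Rightarrow> ennreal" where
  "risk q \<equiv> \<integral>\<^sup>+z. ennreal (sq_loss fhat f z q) \<partial>p"

abbreviation pred_loss :: "nat \<Rightarrow> 'w \<Rightarrow> real" where
  "pred_loss t \<omega> \<equiv> sq_loss fhat f (x t \<omega>) (\<theta> t \<omega>)"

lemma sq_loss_nonneg: "0 \<le> sq_loss fhat f z q"
  by (simp add: sq_loss_def)

lemma input_measurable: "t \<ge> 1 \<Longrightarrow> x t \<in> measurable M p"
  using x_indep by (simp add: indep_vars_def)

lemma parameter_measurable: "t \<ge> 1 \<Longrightarrow> \<theta> t \<in> measurable M \<Theta>"
  using measurable_from_subalg[OF information_subalgebra parameter_from_information] .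

lemma sq_loss_measurable:
  "(\<lambda>(z, q). sq_loss fhat f z q) \<in> borel_measurable (p \<Otimes>\<^sub>M \<Theta>)"
proof -
  have [measurable]: "f \<in> borel_measurable p" using F_measurable target_in_class by auto
  note fhat_measurable [measurable]
  have "(\<lambda>w. (norm ((\<lambda>(z, q). fhat z q) w - f (fst w)))\<^sup>2) \<in> borel_measurable (p \<Otimes>\<^sub>M \<Theta>)"
    by measurable
  then show ?thesis by (simp add: sq_loss_def split_beta')
qed

lemma sq_loss_measurable_input:
  assumes "q \<in> space \<Theta>"
  shows "(\<lambda>z. sq_loss fhat f z q) \<in> borel_measurable p"
  using measurable_compose[OF measurable_Pair2'[OF assms] sq_loss_measurable] by simp

lemma pred_loss_measurable: "t \<ge> 1 \<Longrightarrow> pred_loss t \<in> borel_measurable M"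
  using measurable_compose[OF measurable_Pair[OF input_measurable parameter_measurable]
      sq_loss_measurable] by simp

text \<open>Since \<open>\<theta> t\<close> is measurable for \<open>I t\<close>, independence of
  \<open>x t\<close> from \<open>I t\<close> factorises the probability of every rectangle.
  Rectangles determine the product of two sigma-finite measures.\<close>

lemma distr_input_parameter:
  assumes t: "t \<ge> 1"
  shows "p \<Otimes>\<^sub>M distr M \<Theta> (\<theta> t) = distr M (p \<Otimes>\<^sub>M \<Theta>) (\<lambda>\<omega>. (x t \<omega>, \<theta> t \<omega>))"
proof -
  note [measurable] = input_measurable[OF t] parameter_measurable[OF t]
  interpret p: prob_space p by (rule prob_space_p)
  interpret Q: prob_space "distr M \<Theta> (\<theta> t)" by (rule prob_space_distr) simp
  show ?thesis
  proof (rule pair_measure_eqI)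
    fix A B assume A: "A \<in> sets p" and "B \<in> sets (distr M \<Theta> (\<theta> t))"
    then have B: "B \<in> sets \<Theta>" by simp
    let ?A = "x t -` A \<inter> space M" and ?B = "\<theta> t -` B \<inter> space M"
    have "?B \<in> sets (I t)"
      using measurable_sets[OF parameter_from_information[OF t] B]
        information_subalgebra[of t] by (simp add: subalgebra_def)
    moreover have "?A \<in> sets (vimage_algebra (space M) (x t) p)"
      by (rule in_vimage_algebra[OF A])
    ultimately have "prob (?A \<inter> ?B) = prob ?A * prob ?B"
      using indep_setD[OF input_indep_information[OF t]] by simp
    moreover have "(\<lambda>\<omega>. (x t \<omega>, \<theta> t \<omega>)) -` (A \<times> B) \<inter> space M = ?A \<inter> ?B" by auto
    moreover have "emeasure p A = emeasure M ?A"
      using emeasure_distr[OF input_measurable[OF t] A] x_distr[OF t] by simp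
    ultimately show "emeasure p A * emeasure (distr M \<Theta> (\<theta> t)) B
        = emeasure (distr M (p \<Otimes>\<^sub>M \<Theta>) (\<lambda>\<omega>. (x t \<omega>, \<theta> t \<omega>))) (A \<times> B)"
      using A B by (simp add: emeasure_distr emeasure_eq_measure ennreal_mult)
  qed (simp_all add: p.sigma_finite_measure_axioms Q.sigma_finite_measure_axioms
        cong: sets_pair_measure_cong)
qed

text \<open>Under the product law, Tonelli integrates out the input first, leaving the risk of a
  fixed parameter, which is at least the infimum. Nonnegative integrals avoid any appeal to
  integrability, which is derived only later from the regret bound.\<close>

lemma model_error_le_nn_integral_pred_loss:
  assumes t: "t \<ge> 1"
  shows "(INF q\<in>space \<Theta>. risk q) \<le> (\<integral>\<^sup>+\<omega>. ennreal (pred_loss t \<omega>) \<partial>M)"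
proof -
  define Q where "Q = distr M \<Theta> (\<theta> t)"
  interpret Q: prob_space Q
    unfolding Q_def by (rule prob_space_distr[OF parameter_measurable[OF t]])
  interpret p: prob_space p by (rule prob_space_p)
  interpret pQ: pair_sigma_finite p Q ..
  have joint: "p \<Otimes>\<^sub>M Q = distr M (p \<Otimes>\<^sub>M \<Theta>) (\<lambda>\<omega>. (x t \<omega>, \<theta> t \<omega>))"
    unfolding Q_def by (rule distr_input_parameter[OF t])
  have meas: "(\<lambda>w. ennreal (case w of (z, q) \<Rightarrow> sq_loss fhat f z q)) \<in> borel_measurable (p \<Otimes>\<^sub>M \<Theta>)"
    using sq_loss_measurable by measurable
  then have meas': "(\<lambda>(z, q). ennreal (sq_loss fhat f z q)) \<in> borel_measurable (p \<Otimes>\<^sub>M Q)"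
    by (simp add: Q_def split_beta' cong: measurable_cong_sets)
  have "(INF q\<in>space \<Theta>. risk q) = (\<integral>\<^sup>+q'. (INF q\<in>space \<Theta>. risk q) \<partial>Q)"
    by (simp add: Q.emeasure_space_1)
  also have "\<dots> \<le> (\<integral>\<^sup>+q. risk q \<partial>Q)"
    by (intro nn_integral_mono INF_lower) (simp add: Q_def)
  also have "\<dots> = (\<integral>\<^sup>+w. (case w of (z, q) \<Rightarrow> ennreal (sq_loss fhat f z q)) \<partial>(p \<Otimes>\<^sub>M Q))"
    using pQ.nn_integral_snd[OF meas'] by simp
  also have "\<dots> = (\<integral>\<^sup>+\<omega>. ennreal (pred_loss t \<omega>) \<partial>M)"
    unfolding joint using meas input_measurable[OF t] parameter_measurable[OF t]
    by (subst nn_integral_distr) (auto simp: split_beta')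
  finally show ?thesis .
qed

section \<open>Integrability and the upper bound on summed expected losses\<close>

lemma finite_risk_has_integral:
  assumes q: "q \<in> space \<Theta>" and fin: "risk q < \<infinity>" and t: "t \<ge> 1"
  shows "integrable M (\<lambda>\<omega>. sq_loss fhat f (x t \<omega>) q)"
    and "(\<integral>\<omega>. sq_loss fhat f (x t \<omega>) q \<partial>M) = enn2real (risk q)"
proof -
  note meas = sq_loss_measurable_input[OF q]
  have "integrable p (\<lambda>z. sq_loss fhat f z q)"
    using meas fin by (simp add: integrable_iff_bounded sq_loss_nonneg)
  then show "integrable M (\<lambda>\<omega>. sq_loss fhat f (x t \<omega>) q)"
    using integrable_distr_eq[OF input_measurable[OF t] meas] x_distr[OF t] by simp
  show "(\<integral>\<omega>. sq_loss fhat f (x t \<omega>) q \<partial>M) = enn2real (risk q)"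
    using integral_distr[OF input_measurable[OF t] meas] x_distr[OF t]
      integral_eq_nn_integral[OF meas] by (simp add: sq_loss_nonneg)
qed

text \<open>A real-valued \<open>INF\<close> lies below its members when they are bounded below;
  nonnegativity of the loss supplies the bound 0.\<close>

lemma regret_against_fixed_parameter:
  assumes bound: "(\<Sum>t=1..T. pred_loss t \<omega>)
      \<le> (INF q\<in>space \<Theta>. \<Sum>t=1..T. sq_loss fhat f (x t \<omega>) q) + d"
    and q: "q \<in> space \<Theta>"
  shows "(\<Sum>t=1..T. pred_loss t \<omega>) \<le> (\<Sum>t=1..T. sq_loss fhat f (x t \<omega>) q) + d"
proof -
  have "(INF q\<in>space \<Theta>. \<Sum>t=1..T. sq_loss fhat f (x t \<omega>) q) \<le> (\<Sum>t=1..T. sq_loss fhat f (x t \<omega>) q)"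
    by (intro cINF_lower q bdd_belowI2[where m = 0] sum_nonneg sq_loss_nonneg)
  with bound show ?thesis by simp
qed

text \<open>One prediction loss is at most the sum of all \<open>T\<close> of them, which the regret
  bound dominates by the integrable total loss of \<open>q\<close> plus a constant.\<close>

lemma integrable_pred_loss:
  assumes bound: "\<And>\<omega>. \<omega> \<in> space M \<Longrightarrow>
      (\<Sum>t=1..T. pred_loss t \<omega>) \<le> (\<Sum>t=1..T. sq_loss fhat f (x t \<omega>) q) + d"
    and q: "q \<in> space \<Theta>" "risk q < \<infinity>" and t: "1 \<le> t" "t \<le> T"
  shows "integrable M (pred_loss t)"
proof (rule Bochner_Integration.integrable_bound)
  show "integrable M (\<lambda>\<omega>. (\<Sum>t=1..T. sq_loss fhat f (x t \<omega>) q) + d)"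
    by (intro Bochner_Integration.integrable_add Bochner_Integration.integrable_sum
        finite_risk_has_integral(1) q) auto
  show "pred_loss t \<in> borel_measurable M" by (rule pred_loss_measurable[OF t(1)])
  show "AE \<omega> in M. norm (pred_loss t \<omega>) \<le> norm ((\<Sum>t=1..T. sq_loss fhat f (x t \<omega>) q) + d)"
  proof (rule AE_I2)
    fix \<omega> assume "\<omega> \<in> space M"
    have "pred_loss t \<omega> \<le> (\<Sum>t=1..T. pred_loss t \<omega>)"
      using t by (intro member_le_sum[where f = "\<lambda>t. pred_loss t \<omega>"]) (auto simp: sq_loss_nonneg)
    with bound[OF \<open>\<omega> \<in> space M\<close>]
    show "norm (pred_loss t \<omega>) \<le> norm ((\<Sum>t=1..T. sq_loss fhat f (x t \<omega>) q) + d)"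
      using sq_loss_nonneg[of "x t \<omega>" "\<theta> t \<omega>"] by simp
  qed
qed

text \<open>With \<open>q\<close> fixed before taking expectations, every input has law
  \<open>p\<close>, so each stage contributes the same risk, and the deterministic \<open>d\<close>
  is unchanged.\<close>

lemma sum_expected_pred_loss_le:
  assumes bound: "\<And>\<omega>. \<omega> \<in> space M \<Longrightarrow>
      (\<Sum>t=1..T. pred_loss t \<omega>) \<le> (\<Sum>t=1..T. sq_loss fhat f (x t \<omega>) q) + d"
    and q: "q \<in> space \<Theta>" "risk q < \<infinity>"
  shows "(\<Sum>t=1..T. expectation (pred_loss t)) \<le> real T * enn2real (risk q) + d"
proof -
  have int: "integrable M (\<lambda>\<omega>. sq_loss fhat f (x t \<omega>) q)" if "t \<in> {1..T}" for t
    using finite_risk_has_integral(1)[OF q] that by simp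
  have int': "integrable M (pred_loss t)" if "t \<in> {1..T}" for t
    using integrable_pred_loss[OF bound q] that by simp
  have "(\<Sum>t=1..T. expectation (pred_loss t)) = (\<integral>\<omega>. (\<Sum>t=1..T. pred_loss t \<omega>) \<partial>M)"
    using int' by (rule Bochner_Integration.integral_sum[symmetric])
  also have "\<dots> \<le> (\<integral>\<omega>. (\<Sum>t=1..T. sq_loss fhat f (x t \<omega>) q) + d \<partial>M)"
    using int int' by (intro integral_mono bound Bochner_Integration.integrable_sum
        Bochner_Integration.integrable_add) auto
  also have "\<dots> = (\<Sum>t=1..T. \<integral>\<omega>. sq_loss fhat f (x t \<omega>) q \<partial>M) + d"
    using int by (subst Bochner_Integration.integral_add)
      (auto simp: Bochner_Integration.integral_sum prob_space)
  also have "\<dots> = real T * enn2real (risk q) + d"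
    using finite_risk_has_integral(2)[OF q] by simp
  finally show ?thesis .
qed

end

theorem theorem4:
  fixes M :: "'w measure" and I :: "nat \<Rightarrow> 'w measure"
    and p :: "'x measure" and \<Theta> :: "'p measure"
    and fhat :: "'x \<Rightarrow> 'p \<Rightarrow> 'y::euclidean_space"
    and F :: "('x \<Rightarrow> 'y) set" and f :: "'x \<Rightarrow> 'y"
    and x :: "nat \<Rightarrow> 'w \<Rightarrow> 'x" and \<theta> :: "nat \<Rightarrow> 'w \<Rightarrow> 'p"
    and r_f r_2 :: ennreal
  assumes setting: "online_regression M I p \<Theta> fhat F f x \<theta>"
    and r_f_def: "r_f = model_error p (hypothesis_space (space \<Theta>) fhat) f"
    and r_2_def: "r_2 = representational_error p (hypothesis_space (space \<Theta>) fhat) F"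
    and r_f_finite: "r_f < \<infinity>"
    and regret: "sublinear_external_regret (space M) (space \<Theta>) (sq_loss fhat f) x \<theta>"
  shows "(\<forall>t\<ge>1. integrable M (\<lambda>\<omega>. sq_loss fhat f (x t \<omega>) (\<theta> t \<omega>))) \<and>
    converges_with_increasing_permanence
      (\<lambda>t. \<integral>\<omega>. sq_loss fhat f (x t \<omega>) (\<theta> t \<omega>) \<partial>M) (enn2real r_f) \<and>
    r_f \<in> {0..r_2}"
proof -
  interpret online_regression M I p \<Theta> fhat F f x \<theta> by (rule setting)
  have r_f: "r_f = (INF q\<in>space \<Theta>. risk q)"
    unfolding r_f_def by (rule model_error_hypothesis_space)
  \<comment> \<open>The infimum need not be attained, so a comparator within \<open>e\<close> of it
    is used. Finiteness of \<open>r_f\<close> makes \<open>r_f < r_f + e\<close> strict.\<close>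
  have near_optimal: "\<exists>q\<in>space \<Theta>. risk q < \<infinity> \<and> enn2real (risk q) \<le> enn2real r_f + e"
    if e: "e > 0" for e :: real
  proof -
    have "r_f < r_f + ennreal e"
      using r_f_finite e by (cases r_f) (auto simp: ennreal_plus[symmetric] ennreal_less_iff simp del: ennreal_plus)
    then obtain q where q: "q \<in> space \<Theta>" "risk q < r_f + ennreal e"
      unfolding r_f by (auto simp: INF_less_iff)
    have fin: "r_f + ennreal e < \<infinity>" using r_f_finite by (simp add: ennreal_add_eq_top less_top)
    have "enn2real (risk q) \<le> enn2real (r_f + ennreal e)"
      using q(2) fin by (intro enn2real_mono) auto
    also have "\<dots> = enn2real r_f + e"
      using r_f_finite e by (subst enn2real_plus) auto
    finally show ?thesis using q order_less_trans[OF q(2) fin] by blast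
  qed
  obtain \<Delta> where \<Delta>: "\<Delta> \<in> o(\<lambda>T. real T)"
    and regret_inf: "\<And>\<omega> T. \<omega> \<in> space M \<Longrightarrow> T \<ge> 1 \<Longrightarrow> (\<Sum>t=1..T. pred_loss t \<omega>)
        \<le> (INF q\<in>space \<Theta>. \<Sum>t=1..T. sq_loss fhat f (x t \<omega>) q) + \<Delta> T"
    using regret unfolding sublinear_external_regret_def by blast
  note regret_fixed = regret_against_fixed_parameter[OF regret_inf]
  have integrable: "integrable M (pred_loss t)" if t: "t \<ge> 1" for t
  proof -
    \<comment> \<open>Any comparator of finite risk serves, so the slack 1 is arbitrary; the regret
      bound is applied at horizon \<open>t\<close>.\<close>
    obtain q where q: "q \<in> space \<Theta>" "risk q < \<infinity>" using near_optimal[of 1] by auto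
    show ?thesis
      using integrable_pred_loss[OF regret_fixed[OF _ t q(1)] q t order_refl] .
  qed
  have "converges_with_increasing_permanence (\<lambda>t. expectation (pred_loss t)) (enn2real r_f)"
  proof (rule converges_with_increasing_permanence_average)
    fix t :: nat assume t: "t \<ge> 1"
    \<comment> \<open>Integrability now identifies the nonnegative integral with the expectation,
      which carries the lower bound over to the reals.\<close>
    have "r_f \<le> ennreal (expectation (pred_loss t))"
      using model_error_le_nn_integral_pred_loss[OF t]
        nn_integral_eq_integral[OF integrable[OF t]] by (simp add: r_f sq_loss_nonneg)
    then have "enn2real r_f \<le> enn2real (ennreal (expectation (pred_loss t)))"
      by (rule enn2real_mono) simp
    then show "enn2real r_f \<le> expectation (pred_loss t)"
      by (simp add: sq_loss_nonneg)
  next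
    fix e :: real assume e: "e > 0"
    \<comment> \<open>One half of \<open>e\<close> pays for the suboptimality of \<open>q\<close>,
      the other for \<open>\<Delta> T\<close>, which is eventually at most
      \<open>e / 2 * T\<close>.\<close>
    then obtain q where q: "q \<in> space \<Theta>" "risk q < \<infinity>" "enn2real (risk q) \<le> enn2real r_f + e / 2"
      using near_optimal[of "e / 2"] by auto
    have "\<forall>\<^sub>F T in sequentially. norm (\<Delta> T) \<le> e / 2 * norm (real T)"
      using landau_o.smallD[OF \<Delta>, of "e / 2"] e by simp
    then show "\<forall>\<^sub>F T in sequentially.
        (\<Sum>t=1..T. expectation (pred_loss t)) \<le> real T * (enn2real r_f + e)"
      \<comment> \<open>The regret inequality is available only from \<open>T = 1\<close>
        on.\<close>
      using eventually_ge_at_top[of 1]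
    proof eventually_elim
      case (elim T)
      have "(\<Sum>t=1..T. expectation (pred_loss t)) \<le> real T * enn2real (risk q) + \<Delta> T"
        using elim(2) by (intro sum_expected_pred_loss_le regret_fixed q)
      also have "\<dots> \<le> real T * (enn2real r_f + e / 2) + e / 2 * real T"
        using elim(1) q(3) by (intro add_mono mult_left_mono) auto
      also have "\<dots> = real T * (enn2real r_f + e)" by (simp add: algebra_simps)
      finally show ?case .
    qed
  qed
  moreover have "r_f \<le> r_2"
    unfolding r_f_def r_2_def representational_error_def by (rule SUP_upper[OF target_in_class])
  ultimately show ?thesis using integrable by simp
qed

end
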